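(* Let $m\ge 0$ be an integer and let $d_1>0$ be a real number. For an integer $n$ with $0\le n\le m$, $$\int_0^\infty\frac{z^{2n}\,dz}{\left(z^4+2d_1z^2+1\right)^{m+1}}=\frac{\pi}{2^{3m+3/2}(1+d_1)^{m+1/2}}\sum_{j=0}^{m-n}2^j(1+d_1)^j\binom{2m-2j}{m-j}\binom{m-n+j}{2j}\binom{2j}{j}\binom{m}{j}^{-1}.$$ For an integer $n$ with $m+1\le n\le 2m+1$, $$\int_0^\infty\frac{z^{2n}\,dz}{\left(z^4+2d_1z^2+1\right)^{m+1}}=\frac{\pi}{2^{3m+3/2}(1+d_1)^{m+1/2}}\sum_{j=0}^{n-m-1}2^j(1+d_1)^j\binom{2m-2j}{m-j}\binom{m-n+j}{2j}\binom{2j}{j}\binom{m}{j}^{-1}.$$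
   Context: Binomial coefficients with possibly negative upper entry are the generalized ones: $\binom{x}{r}=\frac{x(x-1)\cdots(x-r+1)}{r!}$ for any integer $x$ and integer $r\ge 0$ (so $\binom{x}{0}=1$). *)

theory Defs
  imports "HOL-Analysis.Analysis"
begin

text \<open>
  The common summand of both closed forms. The upper entry \<open>m - n + j\<close> is a genuine
  integer difference (negative when \<open>m < n\<close>), so that binomial coefficient is the generalized
  one, \<^const>\<open>gbinomial\<close>.
\<close>
definition quartic_term :: "real \<Rightarrow> nat \<Rightarrow> nat \<Rightarrow> nat \<Rightarrow> real" where
  "quartic_term d m n j =
     2 ^ j * (1 + d) ^ j * real ((2 * m - 2 * j) choose (m - j))
       * (real_of_int (int m - int n + int j) gchoose (2 * j))
       * real ((2 * j) choose j) * inverse (real (m choose j))"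

end

theory Submission
  imports Defs
begin

text \<open>
  Put \<open>u = z - 1/z\<close> and \<open>c = 2 * (1 + d)\<close>. Since \<open>z^4 + 2 * d * z^2 + 1 = z^2 * (u^2 + c)\<close>, the
  inversion \<open>z \<mapsto> 1/z\<close> exchanges the integrands for \<open>n\<close> and \<open>2 * m + 1 - n\<close>. Folding \<open>{0<..<1}\<close> onto
  \<open>{1<..}\<close> therefore expresses both integrals through the sum of the two integrands, and this sum
  is \<open>(1 + 1/z^2) * P u / (u^2 + c)^(m+1)\<close> for an even polynomial \<open>P\<close> with binomial coefficients.
  The substitution \<open>u = z - 1/z\<close> leaves Beta integrals over \<open>{0<..}\<close>.
\<close>

section \<open>Change of variables and Beta integrals at half-integers\<close>

text \<open>For nonnegative functions gauge integrability and absolute integrability coincide, so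
  the change-of-variables theorem for absolutely integrable functions transfers existence and value
  of the integral together, in both directions.\<close>

lemma has_integral_substitution_nonneg:
  fixes f g g' :: "real \<Rightarrow> real"
  assumes S: "S \<in> sets lebesgue"
    and der: "\<And>x. x \<in> S \<Longrightarrow> (g has_field_derivative g' x) (at x within S)"
    and inj: "inj_on g S"
    and nonneg: "\<And>y. y \<in> g ` S \<Longrightarrow> 0 \<le> f y"
  shows "(f has_integral I) (g ` S) \<longleftrightarrow> ((\<lambda>x. \<bar>g' x\<bar> * f (g x)) has_integral I) S"
proof -
  have "(f has_integral I) (g ` S) \<longleftrightarrow> f absolutely_integrable_on (g ` S) \<and> integral (g ` S) f = I"
    using nonneg
    by (metis has_integral_iff nonnegative_absolutely_integrable_1 set_lebesgue_integral_eq_integral(1))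
  moreover have "((\<lambda>x. \<bar>g' x\<bar> * f (g x)) has_integral I) S \<longleftrightarrow>
      (\<lambda>x. \<bar>g' x\<bar> * f (g x)) absolutely_integrable_on S \<and> integral S (\<lambda>x. \<bar>g' x\<bar> * f (g x)) = I"
  proof -
    have "0 \<le> \<bar>g' x\<bar> * f (g x)" if "x \<in> S" for x
      using that nonneg by simp
    then show ?thesis
      by (metis (no_types, lifting) has_integral_iff nonnegative_absolutely_integrable_1 set_lebesgue_integral_eq_integral(1))
  qed
  ultimately show ?thesis
    using has_absolute_integral_change_of_variables_1'[OF S der inj, of f I] by blast
qed

lemma Gamma_nat_plus_half: "Gamma (real n + 1/2) = sqrt pi * fact (2 * n) / (4 ^ n * fact n)"
proof -
  have "(1/2::real) \<notin> \<int>\<^sub>\<le>\<^sub>0"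
    by (auto elim!: nonpos_Ints_cases')
  then have "pochhammer (1/2) n = Gamma (1/2 + real n) / Gamma (1/2)"
    by (rule pochhammer_Gamma)
  then have "Gamma (real n + 1/2) = sqrt pi * pochhammer (1/2) n"
    by (simp add: Gamma_one_half_real add.commute)
  then show ?thesis
    by (simp add: fact_double power_mult)
qed

text \<open>The half-integer arguments add up to \<open>j + k + 1\<close>, so the Gamma value in the
  denominator is a factorial; the two factors \<open>sqrt pi\<close> in the numerator combine to
  \<open>pi\<close>.\<close>

lemma Beta_half_half:
  "Beta (real j + 1/2) (real k + 1/2)
     = pi * real ((2 * j) choose j) * real ((2 * k) choose k) / (4 ^ (j + k) * real ((j + k) choose j))"
proof -
  have "Gamma (real j + 1/2 + (real k + 1/2)) = fact (j + k)"
    using Gamma_fact[of "j + k", where 'a = real] by (simp add: algebra_simps)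
  then have "Beta (real j + 1/2) (real k + 1/2)
      = pi * (fact (2 * j) / (4 ^ j * fact j)) * (fact (2 * k) / (4 ^ k * fact k)) / fact (j + k)"
    by (simp add: Beta_def Gamma_nat_plus_half)
  moreover have "real ((2 * i) choose i) = fact (2 * i) / (fact i * fact i)" for i
    by (simp add: binomial_fact)
  moreover have "real ((j + k) choose j) = fact (j + k) / (fact j * fact k)"
    by (simp add: binomial_fact)
  ultimately show ?thesis
    by (simp only:) (simp add: power_add mult_ac)
qed

lemma powr_nat_minus_half: "x powr (real n - 1/2) = x ^ n / sqrt x" if "x > 0" for x :: real
  using that by (simp add: powr_diff powr_realpow powr_half_sqrt)

lemma powr_nat_plus_half: "x powr (real n + 1/2) = x ^ n * sqrt x" if "x > 0" for x :: real
  using that by (simp add: powr_add powr_realpow powr_half_sqrt)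

text \<open>The substitution \<open>t = u^2 / (u^2 + c)\<close>, with
  \<open>1 - t = c / (u^2 + c)\<close>, maps the half-line onto the unit interval and pulls the Beta
  integral back to a constant multiple of this one.\<close>

lemma has_integral_even_power_over_quadratic:
  fixes c :: real
  assumes "c > 0"
  shows "((\<lambda>u. u ^ (2 * j) / (u\<^sup>2 + c) ^ (j + k + 1)) has_integral
           Beta (real j + 1/2) (real k + 1/2) / (2 * c ^ k * sqrt c)) {0<..}"
proof -
  define f where "f t = t powr (real j + 1/2 - 1) * (1 - t) powr (real k + 1/2 - 1)" for t :: real
  define g where "g u = u\<^sup>2 / (u\<^sup>2 + c)" for u :: real
  have pos: "u\<^sup>2 + c > 0" for u
    using assms by (simp add: add_nonneg_pos)
  have image: "g ` {0<..} = {0<..<1}"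
  proof (intro equalityI subsetI)
    fix t assume "t \<in> g ` {0<..}"
    then show "t \<in> {0<..<1}"
      using assms pos by (auto simp: g_def)
  next
    fix t :: real assume t: "t \<in> {0<..<1}"
    \<comment> \<open>The positive solution of \<open>t = u^2 / (u^2 + c)\<close>.\<close>
    define u where "u = sqrt (c * t / (1 - t))"
    have "u > 0" using t assms by (simp add: u_def)
    have u2: "u\<^sup>2 = c * t / (1 - t)" using t assms by (simp add: u_def)
    have "u\<^sup>2 + c = c / (1 - t)" unfolding u2 using t by (simp add: field_simps)
    then have "g u = t"
      unfolding g_def u2 using t assms by (simp add: field_simps)
    with \<open>u > 0\<close> show "t \<in> g ` {0<..}" by force
  qed
  have inj: "inj_on g {0<..}"
  proof (rule inj_onI)
    fix x y assume *: "x \<in> {0<..}" "y \<in> {0<..}" "g x = g y"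
    then have "x\<^sup>2 * (y\<^sup>2 + c) = y\<^sup>2 * (x\<^sup>2 + c)"
      using pos[of x] pos[of y] by (simp add: g_def frac_eq_eq)
    then have "x\<^sup>2 = y\<^sup>2" using assms by (simp add: algebra_simps)
    with * show "x = y" by simp
  qed
  have der: "(g has_field_derivative 2 * u * c / (u\<^sup>2 + c)\<^sup>2) (at u within {0<..})" for u
    unfolding g_def using pos[of u]
    by (auto intro!: derivative_eq_intros simp: power2_eq_square algebra_simps)
  have "(f has_integral Beta (real j + 1/2) (real k + 1/2)) {0..1}"
    unfolding f_def by (rule has_integral_Beta_real) auto
  then have "(f has_integral Beta (real j + 1/2) (real k + 1/2)) (g ` {0<..})"
    by (simp add: image has_integral_Icc_iff_Ioo)
  then have "((\<lambda>u. \<bar>2 * u * c / (u\<^sup>2 + c)\<^sup>2\<bar> * f (g u)) has_integral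
      Beta (real j + 1/2) (real k + 1/2)) {0<..}"
    by (subst (asm) has_integral_substitution_nonneg[OF _ der inj]) (auto simp: f_def)
  moreover have "\<bar>2 * u * c / (u\<^sup>2 + c)\<^sup>2\<bar> * f (g u)
      = 2 * c ^ k * sqrt c * (u ^ (2 * j) / (u\<^sup>2 + c) ^ (j + k + 1))" if "u \<in> {0<..}" for u
  proof -
    from that have "u > 0" by simp
    define s where "s = u\<^sup>2 + c"
    have "s > 0" using pos by (simp add: s_def)
    have "1 - g u = c / s"
      using \<open>s > 0\<close> by (simp add: g_def s_def field_simps)
    moreover have "(u\<^sup>2 / s) powr (real j - 1/2) = (u\<^sup>2 / s) ^ j / (u / sqrt s)"
      using \<open>u > 0\<close> \<open>s > 0\<close> by (simp add: powr_nat_minus_half real_sqrt_divide)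
    moreover have "(c / s) powr (real k - 1/2) = (c / s) ^ k / (sqrt c / sqrt s)"
      using assms \<open>s > 0\<close> by (simp add: powr_nat_minus_half real_sqrt_divide)
    ultimately have "f (g u) = (u\<^sup>2 / s) ^ j / (u / sqrt s) * ((c / s) ^ k / (sqrt c / sqrt s))"
      by (simp add: f_def) (simp add: g_def s_def)
    \<comment> \<open>The two half powers contribute one \<open>sqrt s\<close> each, so
      \<open>s\<close> occurs only with integer exponents afterwards.\<close>
    also have "\<dots> = (u\<^sup>2) ^ j * c ^ k * (sqrt s * sqrt s) / (s ^ (j + k) * u * sqrt c)"
      by (simp only: power_divide power_add divide_divide_eq_right times_divide_times_eq
          times_divide_eq_left times_divide_eq_right divide_divide_eq_left mult_ac)
    also have "\<dots> = u ^ (2 * j) * c ^ k * s / (s ^ (j + k) * u * sqrt c)"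
      using \<open>s > 0\<close> by (simp add: power_mult)
    finally have "f (g u) = u ^ (2 * j) * c ^ k * s / (s ^ (j + k) * u * sqrt c)" .
    \<comment> \<open>The factor \<open>c\<close> of the derivative is split into square roots so
      that one of them cancels.\<close>
    then have "\<bar>2 * u * c / s\<^sup>2\<bar> * f (g u)
        = 2 * u * (sqrt c * sqrt c) / s\<^sup>2 * (u ^ (2 * j) * c ^ k * s / (s ^ (j + k) * u * sqrt c))"
      using \<open>u > 0\<close> assms by simp
    also have "\<dots> = 2 * c ^ k * sqrt c * (u ^ (2 * j) / s ^ (j + k + 1))"
      using \<open>u > 0\<close> \<open>s > 0\<close> assms by (simp add: divide_simps power2_eq_square)
    finally show ?thesis by (simp add: s_def)
  qed
  ultimately have "((\<lambda>u. 2 * c ^ k * sqrt c * (u ^ (2 * j) / (u\<^sup>2 + c) ^ (j + k + 1))) has_integral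
      Beta (real j + 1/2) (real k + 1/2)) {0<..}"
    by (subst (asm) has_integral_cong) auto
  from has_integral_mult_right[OF this, of "1 / (2 * c ^ k * sqrt c)"] show ?thesis
    using assms by simp
qed

section \<open>Odd power sums as polynomials in the difference\<close>

text \<open>Since \<open>z * w = 1\<close>, multiplying by \<open>u = z - w\<close> links sums of
  odd powers to differences of even powers in an alternating recurrence. The binomial sums obey the
  same recurrence by Pascal's rule, so both identities are proved by one simultaneous
  induction.\<close>

lemma power_sum_as_difference_polynomial:
  fixes z w :: "'a::comm_ring_1"
  assumes "z * w = 1"
  shows "z ^ (2 * k + 1) + w ^ (2 * k + 1)
           = (z + w) * (\<Sum>j\<le>k. of_nat ((k + j) choose (2 * j)) * (z - w) ^ (2 * j))" (is "?A k")
    and "z ^ (2 * k + 2) - w ^ (2 * k + 2)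
           = (z + w) * (\<Sum>j\<le>k. of_nat ((k + j + 1) choose (2 * j + 1)) * (z - w) ^ (2 * j + 1))"
      (is "?B k")
proof -
  define u where "u = z - w"
  define a where "a k = (\<Sum>j\<le>k. of_nat ((k + j) choose (2 * j)) * u ^ (2 * j))" for k
  define b where "b k = (\<Sum>j\<le>k. of_nat ((k + j + 1) choose (2 * j + 1)) * u ^ (2 * j + 1))" for k
  have a_Suc: "a (Suc k) = u * b k + a k" for k
  proof -
    have "a (Suc k) = 1 + (\<Sum>j\<le>k. of_nat ((k + j + 2) choose (2 * j + 2)) * u ^ (2 * j + 2))"
      unfolding a_def by (subst sum.atMost_Suc_shift) simp
    \<comment> \<open>Pascal's rule splits each coefficient; the parts with lower entry
      \<open>2 * j + 1\<close> form \<open>u * b k\<close>.\<close>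
    also have "\<dots> = u * b k + (1 + (\<Sum>j\<le>k. of_nat ((k + j + 1) choose (2 * j + 2)) * u ^ (2 * j + 2)))"
      unfolding b_def by (simp add: sum_distrib_left algebra_simps flip: sum.distrib)
    also have "1 + (\<Sum>j\<le>k. of_nat ((k + j + 1) choose (2 * j + 2)) * u ^ (2 * j + 2))
        = (\<Sum>j\<le>Suc k. of_nat ((k + j) choose (2 * j)) * u ^ (2 * j))"
      by (subst sum.atMost_Suc_shift) simp
    \<comment> \<open>The summand at \<open>Suc k\<close> vanishes, its coefficient being
      \<open>2 * k + 1\<close> over \<open>2 * k + 2\<close>.\<close>
    also have "\<dots> = a k"
      by (simp add: a_def binomial_eq_0)
    finally show ?thesis .
  qed
  have b_Suc: "b (Suc k) = u * a (Suc k) + b k" for k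
  proof -
    have "b (Suc k) = u * a (Suc k) + (\<Sum>j\<le>Suc k. of_nat ((k + j + 1) choose (2 * j + 1)) * u ^ (2 * j + 1))"
      unfolding a_def b_def
      by (simp add: sum_distrib_left algebra_simps flip: sum.distrib del: sum.atMost_Suc)
    also have "(\<Sum>j\<le>Suc k. of_nat ((k + j + 1) choose (2 * j + 1)) * u ^ (2 * j + 1)) = b k"
      by (simp add: b_def binomial_eq_0)
    finally show ?thesis .
  qed
  have wz: "w * (z * x) = x" "z * (w * x) = x" for x
    using assms by (metis mult.assoc mult.commute mult_1)+
  \<comment> \<open>In the product with \<open>u\<close>, the mixed terms lose two degrees through
    \<open>z * w = 1\<close>.\<close>
  have minus: "z ^ (i + 2) - w ^ (i + 2) = u * (z ^ (i + 1) + w ^ (i + 1)) + (z ^ i - w ^ i)"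
    and plus: "z ^ (i + 2) + w ^ (i + 2) = u * (z ^ (i + 1) - w ^ (i + 1)) + (z ^ i + w ^ i)" for i
    by (simp_all add: u_def algebra_simps wz)
  have "z ^ (2 * k + 1) + w ^ (2 * k + 1) = (z + w) * a k \<and>
        z ^ (2 * k + 2) - w ^ (2 * k + 2) = (z + w) * b k" for k
  proof (induction k)
    case 0
    then show ?case
      by (simp add: a_def b_def u_def algebra_simps power2_eq_square)
  next
    case (Suc k)
    have "z ^ (2 * Suc k + 1) + w ^ (2 * Suc k + 1) = (z + w) * a (Suc k)"
      using plus[of "2 * k + 1"] Suc by (simp add: a_Suc algebra_simps)
    moreover from this have "z ^ (2 * Suc k + 2) - w ^ (2 * Suc k + 2) = (z + w) * b (Suc k)"
      using minus[of "2 * k + 2"] Suc by (simp add: b_Suc algebra_simps)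
    ultimately show ?case by blast
  qed
  then show "?A k" "?B k"
    by (auto simp: a_def b_def u_def)
qed

section \<open>Symmetry and folding of the quartic integrand\<close>

context
  fixes d :: real and m :: nat
  assumes d: "d > 0"
begin

definition integrand :: "nat \<Rightarrow> real \<Rightarrow> real" where
  "integrand n z = z ^ (2 * n) / (z ^ 4 + 2 * d * z\<^sup>2 + 1) ^ (m + 1)"

lemma quartic_pos: "z ^ 4 + 2 * d * z\<^sup>2 + 1 > 0"
  using d by (simp add: add_nonneg_pos)

lemma integrand_nonneg: "integrand n z \<ge> 0"
  unfolding integrand_def using quartic_pos[of z]
  by (intro divide_nonneg_pos zero_less_power) auto

text \<open>The quartic is palindromic: its value at \<open>1 / z\<close> is its value at
  \<open>z\<close> divided by \<open>z ^ 4\<close>. The factor \<open>1 / z^2\<close> is the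
  Jacobian of the inversion, so the exponent becomes \<open>4 * (m + 1) - 2 * n - 2\<close>.\<close>

lemma integrand_inverse:
  assumes "n \<le> 2 * m + 1" "z > 0"
  shows "integrand n (1 / z) / z\<^sup>2 = integrand (2 * m + 1 - n) z"
proof -
  define q where "q = z ^ 4 + 2 * d * z\<^sup>2 + 1"
  have "q > 0" unfolding q_def by (rule quartic_pos)
  have "(1/z) ^ 4 + 2 * d * (1/z)\<^sup>2 + 1 = q / z ^ 4"
    using assms unfolding q_def by (simp add: field_simps power2_eq_square power4_eq_xxxx)
  then have "integrand n (1 / z) / z\<^sup>2 = z ^ (4 * (m + 1)) / (z ^ (2 * n + 2) * q ^ (m + 1))"
    by (simp add: integrand_def power_divide power_add power_mult power2_eq_square)
  also have "4 * (m + 1) = 2 * (2 * m + 1 - n) + (2 * n + 2)"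
    using assms by simp
  also have "z ^ \<dots> / (z ^ (2 * n + 2) * q ^ (m + 1)) = z ^ (2 * (2 * m + 1 - n)) / q ^ (m + 1)"
    using assms by (subst power_add) simp
  finally show ?thesis by (simp add: integrand_def q_def)
qed

text \<open>The prefactor \<open>1 + 1 / z^2\<close> is the derivative of \<open>z - 1 / z\<close>,
  which prepares the substitution; the rest depends on \<open>z\<close> only through that
  difference.\<close>

lemma integrand_add_reflected:
  assumes "n \<le> m" "z > 0"
  shows "integrand n z + integrand (2 * m + 1 - n) z
    = (1 + 1 / z\<^sup>2) * (\<Sum>j\<le>m - n. real ((m - n + j) choose (2 * j)) *
        ((z - 1 / z) ^ (2 * j) / ((z - 1 / z)\<^sup>2 + 2 * (1 + d)) ^ (m + 1)))"
proof -
  define k where "k = m - n"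
  define s where "s = (z - 1 / z)\<^sup>2 + 2 * (1 + d)"
  define P where "P = (\<Sum>j\<le>k. real ((k + j) choose (2 * j)) * (z - 1 / z) ^ (2 * j))"
  have "s > 0" using d by (simp add: s_def add_nonneg_pos)
  have m: "m = n + k" using assms by (simp add: k_def)
  then have reflected: "2 * m + 1 - n = n + 2 * k + 1" by simp
  have "z ^ 4 + 2 * d * z\<^sup>2 + 1 = z\<^sup>2 * s"
    using assms by (simp add: s_def field_simps power2_eq_square power4_eq_xxxx)
  then have "integrand n z + integrand (2 * m + 1 - n) z
      = (z ^ (2 * n) + z ^ (2 * (n + 2 * k + 1))) / (z ^ (2 * (m + 1)) * s ^ (m + 1))"
    by (simp only: integrand_def reflected power_mult_distrib add_divide_distrib power_mult)
  \<comment> \<open>The exponent \<open>2 * n + 2 * k + 1\<close> is the mean of the two on the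
    left; factoring it out leaves powers of \<open>z\<close> and \<open>1 / z\<close>
    symmetrically.\<close>
  also have "z ^ (2 * n) + z ^ (2 * (n + 2 * k + 1))
      = z ^ (2 * n + 2 * k + 1) * (z ^ (2 * k + 1) + (1 / z) ^ (2 * k + 1))"
  proof -
    have "z ^ (2 * n + 2 * k + 1) * (1 / z) ^ (2 * k + 1) = z ^ (2 * n) * (z * (1 / z)) ^ (2 * k + 1)"
      by (simp only: power_add power_mult_distrib mult_ac)
    then have "z ^ (2 * n + 2 * k + 1) * (1 / z) ^ (2 * k + 1) = z ^ (2 * n)"
      using assms by simp
    moreover have "z ^ (2 * n + 2 * k + 1) * z ^ (2 * k + 1) = z ^ (2 * (n + 2 * k + 1))"
      by (simp flip: power_add add: algebra_simps)
    ultimately show ?thesis by (simp only: distrib_left add.commute)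
  qed
  also have "z ^ (2 * k + 1) + (1 / z) ^ (2 * k + 1) = (z + 1 / z) * P"
    unfolding P_def using assms by (intro power_sum_as_difference_polynomial) simp
  also have "z ^ (2 * n + 2 * k + 1) * ((z + 1 / z) * P) / (z ^ (2 * (m + 1)) * s ^ (m + 1))
      = (1 + 1 / z\<^sup>2) * (P / s ^ (m + 1))"
    using assms \<open>s > 0\<close> by (simp add: m power_add field_simps power2_eq_square)
  finally show ?thesis
    by (simp add: P_def s_def k_def sum_divide_distrib)
qed

lemma has_integral_even_polynomial:
  assumes "k \<le> m"
  shows "((\<lambda>u. \<Sum>j\<le>k. real ((k + j) choose (2 * j)) * (u ^ (2 * j) / (u\<^sup>2 + 2 * (1 + d)) ^ (m + 1)))
      has_integral (\<Sum>j\<le>k. real ((k + j) choose (2 * j)) *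
        (Beta (real j + 1/2) (real (m - j) + 1/2) / (2 * (2 * (1 + d)) ^ (m - j) * sqrt (2 * (1 + d))))))
      {0<..}"
proof (intro has_integral_sum has_integral_mult_right)
  fix j assume "j \<in> {..k}"
  then have "j + (m - j) + 1 = m + 1" using assms by simp
  then show "((\<lambda>u. u ^ (2 * j) / (u\<^sup>2 + 2 * (1 + d)) ^ (m + 1)) has_integral
      Beta (real j + 1/2) (real (m - j) + 1/2) / (2 * (2 * (1 + d)) ^ (m - j) * sqrt (2 * (1 + d)))) {0<..}"
    using has_integral_even_power_over_quadratic[of "2 * (1 + d)" j "m - j"] d by simp
qed simp

text \<open>The map \<open>z - 1 / z\<close> is an increasing bijection from \<open>{1<..}\<close>
  onto \<open>{0<..}\<close> whose derivative is exactly the prefactor in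
  \<open>integrand_add_reflected\<close>.\<close>

lemma has_integral_integrand_add_reflected:
  assumes "n \<le> m"
    and "((\<lambda>u. \<Sum>j\<le>m - n. real ((m - n + j) choose (2 * j)) *
        (u ^ (2 * j) / (u\<^sup>2 + 2 * (1 + d)) ^ (m + 1))) has_integral I) {0<..}" (is "(?f has_integral I) _")
  shows "((\<lambda>z. integrand n z + integrand (2 * m + 1 - n) z) has_integral I) {1<..}"
proof -
  define g where "g z = z - 1 / z" for z :: real
  have image: "g ` {1<..} = {0<..}"
  proof (intro equalityI subsetI)
    fix u assume "u \<in> g ` {1<..}"
    then obtain z where "z > 1" "u = g z" by auto
    then show "u \<in> {0<..}"
      using less_trans[of "1 / z" 1 z] by (simp add: g_def)
  next
    fix u :: real assume u: "u \<in> {0<..}"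
    \<comment> \<open>The square root of the discriminant of \<open>z^2 - u * z - 1\<close>, whose
      positive root is the preimage of \<open>u\<close>.\<close>
    define r where "r = sqrt (u\<^sup>2 + 4)"
    have r2: "r * r = u * u + 4" by (simp add: r_def power2_eq_square)
    have "r > 2" unfolding r_def using u by (intro real_less_rsqrt) simp
    define z where "z = (u + r) / 2"
    have "z > 1" using u \<open>r > 2\<close> by (simp add: z_def)
    moreover have "z * z = u * z + 1" using r2 by (simp add: z_def field_simps)
    then have "g z = u" using \<open>z > 1\<close> by (simp add: g_def field_simps)
    ultimately show "u \<in> g ` {1<..}" by force
  qed
  have inj: "inj_on g {1<..}"
  proof (rule linorder_inj_onI)
    fix x y :: real assume "x < y" "x \<in> {1<..}" "y \<in> {1<..}"
    then show "g x \<noteq> g y"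
    using frac_less2[of 1 1 x y] by (auto simp: g_def)
  qed auto
  have der: "(g has_field_derivative 1 + 1 / z\<^sup>2) (at z within {1<..})" if "z \<in> {1<..}" for z
    unfolding g_def using that by (auto intro!: derivative_eq_intros simp: power2_eq_square)
  have nonneg: "0 \<le> ?f u" for u
    using d by (intro sum_nonneg mult_nonneg_nonneg divide_nonneg_nonneg) simp_all
  have "((\<lambda>z. \<bar>1 + 1 / z\<^sup>2\<bar> * ?f (g z)) has_integral I) {1<..}"
    using has_integral_substitution_nonneg[OF _ der inj nonneg] assms(2) unfolding image by simp
  then show ?thesis
    by (rule has_integral_eq[rotated]) (use integrand_add_reflected[OF assms(1)] in \<open>simp add: g_def\<close>)
qed

text \<open>Inversion turns the part over \<open>{0<..<1}\<close> into the integral of the reflected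
  integrand over \<open>{1<..}\<close>, so the two halves together give the integral of the
  sum.\<close>

lemma has_integral_integrand:
  assumes n: "n \<le> 2 * m + 1"
    and I: "((\<lambda>z. integrand n z + integrand (2 * m + 1 - n) z) has_integral I) {1<..}"
  shows "(integrand n has_integral I) {0..}"
proof -
  \<comment> \<open>Integrability is given for the sum only; each summand inherits it because both
    are nonnegative and hence dominated by the sum.\<close>
  have int: "integrand i integrable_on {1<..}" if "i = n \<or> i = 2 * m + 1 - n" for i
  proof (rule measurable_bounded_by_integrable_imp_integrable)
    have "integrand i \<in> borel_measurable lborel"
      unfolding integrand_def by measurable
    then show "integrand i \<in> borel_measurable (lebesgue_on {1<..})"
      by (intro measurable_restrict_space1 measurable_completion)
    show "(\<lambda>z. integrand n z + integrand (2 * m + 1 - n) z) integrable_on {1<..}"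
      using I by blast
    show "norm (integrand i z) \<le> integrand n z + integrand (2 * m + 1 - n) z" for z
      using that integrand_nonneg[of n z] integrand_nonneg[of "2 * m + 1 - n" z] by auto
  qed auto
  define J K where "J = integral {1<..} (integrand n)" and "K = integral {1<..} (integrand (2 * m + 1 - n))"
  have J: "(integrand n has_integral J) {1<..}" and K: "(integrand (2 * m + 1 - n) has_integral K) {1<..}"
    unfolding J_def K_def using int by auto
  have "I = J + K"
    using has_integral_unique[OF I has_integral_add[OF J K]] .
  have image: "(\<lambda>z. 1 / z) ` {1<..} = {0<..<1::real}"
  proof (intro equalityI subsetI)
    fix w :: real assume "w \<in> {0<..<1}"
    then show "w \<in> (\<lambda>z. 1 / z) ` {1<..}"
      by (intro image_eqI[of _ _ "1 / w"]) auto
  qed auto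
  have "(integrand n has_integral K) {0<..<1} \<longleftrightarrow>
      ((\<lambda>z. \<bar>- 1 / z\<^sup>2\<bar> * integrand n (1 / z)) has_integral K) {1<..}"
    unfolding image[symmetric]
    by (rule has_integral_substitution_nonneg)
      (auto intro!: derivative_eq_intros inj_onI integrand_nonneg simp: power2_eq_square)
  also have "\<dots> \<longleftrightarrow> (integrand (2 * m + 1 - n) has_integral K) {1<..}"
    using integrand_inverse[OF n] by (intro has_integral_cong) simp
  finally have "(integrand n has_integral K) {0<..<1}"
    using K by simp
  moreover have "{1<..} \<inter> {0<..<1::real} = {}" by auto
  ultimately have "(integrand n has_integral I) ({1<..} \<union> {0<..<1})"
    unfolding \<open>I = J + K\<close> using J by (intro has_integral_Un) simp_all
  \<comment> \<open>The half-line differs from the two open pieces only by the points 0 and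
    1.\<close>
  then show ?thesis
  proof (subst has_integral_spike_set_eq)
    show "negligible {x \<in> {0..} - ({1<..} \<union> {0<..<1}). integrand n x \<noteq> 0}"
      by (rule negligible_subset[of "{0, 1}"]) auto
    show "negligible {x \<in> {1<..} \<union> {0<..<1} - {0..}. integrand n x \<noteq> 0}"
      by (rule negligible_subset[of "{}"]) auto
  qed
qed

section \<open>Matching the closed form in both ranges of \<open>n\<close>\<close>

text \<open>With \<open>8 ^ m = 4 ^ m * 2 ^ m\<close>, the factor \<open>4 ^ m\<close> comes from
  the Beta value, while \<open>2 ^ j * (1 + d) ^ j\<close> reduces the remaining powers from
  \<open>m\<close> to \<open>m - j\<close>. Leaving \<open>k\<close> free and assuming the binomial
  identity lets both ranges of \<open>n\<close> share the computation.\<close>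

lemma quartic_term_as_Beta:
  assumes "j \<le> m" "real_of_int (int m - int n + int j) gchoose (2 * j) = real ((k + j) choose (2 * j))"
  shows "pi / (2 powr (3 * real m + 3 / 2) * (1 + d) powr (real m + 1 / 2)) * quartic_term d m n j
    = real ((k + j) choose (2 * j)) *
        (Beta (real j + 1/2) (real (m - j) + 1/2) / (2 * (2 * (1 + d)) ^ (m - j) * sqrt (2 * (1 + d))))"
proof -
  define i where "i = m - j"
  have m: "m = j + i" using assms(1) by (simp add: i_def)
  have "2 powr (3 * real m + 3 / 2) = 2 powr (real (3 * m + 1) + 1 / 2)"
    by (simp add: add.commute)
  also have "\<dots> = 8 ^ m * 2 * sqrt 2"
    by (subst powr_nat_plus_half) (simp_all add: power_mult)
  finally have 1: "2 powr (3 * real m + 3 / 2) = 8 ^ m * 2 * sqrt 2" .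
  define e where "e = 1 + d"
  have "e > 0" using d by (simp add: e_def)
  then have 2: "e powr (real m + 1 / 2) = e ^ m * sqrt e"
    by (rule powr_nat_plus_half)
  have 3: "(8::real) ^ i = 4 ^ i * 2 ^ i" for i
    by (simp flip: power_mult_distrib)
  have 4: "2 * m - 2 * j = 2 * i" using m by simp
  from \<open>e > 0\<close> show ?thesis
    unfolding e_def[symmetric] 1 2 quartic_term_def assms(2) Beta_half_half i_def[symmetric] 4 3
    by (simp add: m power_add real_sqrt_mult divide_simps)
qed

text \<open>The sum of the two integrands is unchanged when \<open>n\<close> and
  \<open>2 * m + 1 - n\<close> are swapped, so both indices yield the same integral; only the form
  of the binomial coefficient varies with \<open>i\<close>.\<close>

lemma has_integral_integrand_quartic_term:
  assumes "n \<le> m" "i = n \<or> i = 2 * m + 1 - n"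
    and "\<And>j. j \<le> m - n \<Longrightarrow>
      real_of_int (int m - int i + int j) gchoose (2 * j) = real ((m - n + j) choose (2 * j))"
  shows "(integrand i has_integral
    pi / (2 powr (3 * real m + 3 / 2) * (1 + d) powr (real m + 1 / 2))
      * (\<Sum>j=0..m - n. quartic_term d m i j)) {0..}"
proof -
  let ?I = "\<Sum>j\<le>m - n. real ((m - n + j) choose (2 * j)) *
    (Beta (real j + 1/2) (real (m - j) + 1/2) / (2 * (2 * (1 + d)) ^ (m - j) * sqrt (2 * (1 + d))))"
  have "?I = pi / (2 powr (3 * real m + 3 / 2) * (1 + d) powr (real m + 1 / 2))
      * (\<Sum>j=0..m - n. quartic_term d m i j)"
    unfolding sum_distrib_left atLeast0AtMost
    by (intro sum.cong quartic_term_as_Beta[symmetric] assms(3)) auto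
  moreover have "((\<lambda>z. integrand n z + integrand (2 * m + 1 - n) z) has_integral ?I) {1<..}"
    by (intro has_integral_integrand_add_reflected has_integral_even_polynomial assms) simp
  then have "((\<lambda>z. integrand i z + integrand (2 * m + 1 - i) z) has_integral ?I) {1<..}"
    using assms(1,2) by (auto simp: add.commute)
  then have "(integrand i has_integral ?I) {0..}"
    using assms by (intro has_integral_integrand) auto
  ultimately show ?thesis by simp
qed

end

theorem theorem3p1:
  fixes m n :: nat and d\<^sub>1 :: real
  assumes "d\<^sub>1 > 0"
  shows "(n \<le> m \<longrightarrow>
            ((\<lambda>z::real. z ^ (2 * n) / (z ^ 4 + 2 * d\<^sub>1 * z\<^sup>2 + 1) ^ (m + 1)) has_integral
              pi / (2 powr (3 * real m + 3 / 2) * (1 + d\<^sub>1) powr (real m + 1 / 2))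
                * (\<Sum>j=0..m - n. quartic_term d\<^sub>1 m n j)) {0..})
       \<and> (m + 1 \<le> n \<and> n \<le> 2 * m + 1 \<longrightarrow>
            ((\<lambda>z::real. z ^ (2 * n) / (z ^ 4 + 2 * d\<^sub>1 * z\<^sup>2 + 1) ^ (m + 1)) has_integral
              pi / (2 powr (3 * real m + 3 / 2) * (1 + d\<^sub>1) powr (real m + 1 / 2))
                * (\<Sum>j=0..n - m - 1. quartic_term d\<^sub>1 m n j)) {0..})"
proof (intro conjI impI)
  assume n: "n \<le> m"
  have "real_of_int (int m - int n + int j) gchoose (2 * j) = real ((m - n + j) choose (2 * j))" for j
    using n by (simp add: binomial_gbinomial algebra_simps)
  then show "((\<lambda>z::real. z ^ (2 * n) / (z ^ 4 + 2 * d\<^sub>1 * z\<^sup>2 + 1) ^ (m + 1)) has_integral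
      pi / (2 powr (3 * real m + 3 / 2) * (1 + d\<^sub>1) powr (real m + 1 / 2))
        * (\<Sum>j=0..m - n. quartic_term d\<^sub>1 m n j)) {0..}"
    using has_integral_integrand_quartic_term[OF assms n, of n]
    by (simp add: integrand_def[OF assms, abs_def])
next
  assume n: "m + 1 \<le> n \<and> n \<le> 2 * m + 1"
  \<comment> \<open>Reflection moves the second range of \<open>n\<close> into the first.\<close>
  define n' where "n' = 2 * m + 1 - n"
  have n': "n' \<le> m" "n = 2 * m + 1 - n'" "n - m - 1 = m - n'"
    using n by (auto simp: n'_def)
  have "real_of_int (int m - int n + int j) gchoose (2 * j) = real ((m - n' + j) choose (2 * j))" for j
  proof -
    have "real_of_int (int m - int n + int j) gchoose (2 * j)
        = (real (2 * j) - real_of_int (int m - int n + int j) - 1) gchoose (2 * j)"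
      \<comment> \<open>The sign \<open>(-1) ^ (2 * j)\<close> is 1 because the lower entry is
        even.\<close>
      by (subst gbinomial_negated_upper) simp
    also have "real (2 * j) - real_of_int (int m - int n + int j) - 1 = real (m - n' + j)"
      using n by (simp add: n'_def)
    finally show ?thesis by (simp add: binomial_gbinomial)
  qed
  then show "((\<lambda>z::real. z ^ (2 * n) / (z ^ 4 + 2 * d\<^sub>1 * z\<^sup>2 + 1) ^ (m + 1)) has_integral
      pi / (2 powr (3 * real m + 3 / 2) * (1 + d\<^sub>1) powr (real m + 1 / 2))
        * (\<Sum>j=0..n - m - 1. quartic_term d\<^sub>1 m n j)) {0..}"
    using has_integral_integrand_quartic_term[OF assms n'(1), of n] n'
    by (simp add: integrand_def[OF assms, abs_def])
qed

end
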